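(* Let $G$ be a finite group, let $C=(\mathcal{X},\mathcal{K})$ be a supercharacter theory of $G$ with $\mathcal{X}=\{X_1,\ldots,X_m\}$, and let $K$ be a field. The following are equivalent: (1) $G$ is $C$-almost monomial. (2) For any $k\neq\ell\in\{1,\ldots,m\}$, there exist integers $\alpha_i\geq 0$ such that $F_1^{\alpha_1}\cdots F_m^{\alpha_m}\in R_{G,C}$, with $\alpha_k>0$ and $\alpha_\ell=0$. (3) For any $\ell\in\{1,\ldots,m\}$, there exist integers $\alpha_i>0$ ($i\neq\ell$) such that $F_1^{\alpha_1}\cdots F_{\ell-1}^{\alpha_{\ell-1}}\cdot F_{\ell+1}^{\alpha_{\ell+1}}\cdots F_m^{\alpha_m}\in R_{G,C}$.
   Context: Characters are complex characters of finite groups. A supercharacter theory of a finite group $G$ is a pair $C=(\mathcal{X},\mathcal{K})$, where $\mathcal{X}$ is a partition of $\operatorname{Irr}(G)$ and $\mathcal{K}$ is a partition of $G$, such that $\{1\}\in\mathcal{K}$, $|\mathcal{X}|=|\mathcal{K}|$, and for each $X\in\mathcal{X}$ the character $\sigma_X=\sum_{\psi\in X}\psi(1)\psi$ is constant on each member of $\mathcal{K}$. Let $\operatorname{Irr}(G)=\{\chi_1,\ldots,\chi_r\}$, $d_j=\chi_j(1)$, $\operatorname{Ch}(G)=\{\sum_j a_j\chi_j : a_j\in\mathbb{N}\}$, and $\operatorname{Ch}(G,C)=\{a_1\sigma_{X_1}+\cdots+a_m\sigma_{X_m}: a_i\in\mathbb{N}\}\subset\operatorname{Ch}(G)$. $M(G)$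 is the submonoid of $\operatorname{Ch}(G)$ generated by the monomial characters, i.e. the induced characters $\lambda^G$ with $\lambda$ a linear (degree one) character of a subgroup of $G$. Put $M(G,C)=\operatorname{Ch}(G,C)\cap M(G)$. In $K[x_1,\ldots,x_r]$ let $F_i=\prod_{\chi_j\in X_i}x_j^{d_j}$, $1\leq i\leq m$, and let $R_{G,C}=K[M(G,C)]\subset K[F_1,\ldots,F_m]$ be the $K$-subalgebra spanned by the monomials $F_1^{a_1}\cdots F_m^{a_m}$ with $a_1\sigma_{X_1}+\cdots+a_m\sigma_{X_m}\in M(G,C)$. $G$ is $C$-almost monomial if for any $k\neq\ell$ in $\{1,\ldots,m\}$ there exist subgroups $H_1,\ldots,H_t\leqslant G$ (not necessarily distinct) and linear characters $\lambda_1,\ldots,\lambda_t$ of $H_1,\ldots,H_t$ such that $\lambda_1^G+\cdots+\lambda_t^G=\sum_{i=1}^m\alpha_i\sigma_{X_i}$, where $\alpha_i\geq0$ are integers with $\alpha_k>0$ and $\alpha_\ell=0$. *)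

theory Defs
  imports
    "HOL-Algebra.Group"
    "HOL-Library.Disjoint_Sets"
    "HOL-Library.Poly_Mapping"
    "Jordan_Normal_Form.VS_Connect"
begin

section \<open>Complex characters\<close>

definition matrix_rep :: "('g, 'b) monoid_scheme \<Rightarrow> nat \<Rightarrow> ('g \<Rightarrow> complex mat) \<Rightarrow> bool" where
  "matrix_rep G n \<rho> \<longleftrightarrow>
     (\<forall>g\<in>carrier G. \<rho> g \<in> carrier_mat n n) \<and>
     \<rho> \<one>\<^bsub>G\<^esub> = 1\<^sub>m n \<and>
     (\<forall>g\<in>carrier G. \<forall>h\<in>carrier G. \<rho> (g \<otimes>\<^bsub>G\<^esub> h) = \<rho> g * \<rho> h)"

definition irreducible_rep :: "('g, 'b) monoid_scheme \<Rightarrow> nat \<Rightarrow> ('g \<Rightarrow> complex mat) \<Rightarrow> bool" where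
  "irreducible_rep G n \<rho> \<longleftrightarrow>
     matrix_rep G n \<rho> \<and> n > 0 \<and>
     (\<forall>W. VectorSpace.subspace class_ring W (module_vec TYPE(complex) n) \<and>
          (\<forall>g\<in>carrier G. \<forall>w\<in>W. \<rho> g *\<^sub>v w \<in> W) \<longrightarrow>
          W = {0\<^sub>v n} \<or> W = carrier_vec n)"

text \<open>
  Characters are total functions on the ambient type, set to 0 off the carrier, so that
  equality of functions is equality on the group and pointwise sums of characters have
  the same form.
\<close>

definition rep_character :: "('g, 'b) monoid_scheme \<Rightarrow> ('g \<Rightarrow> complex mat) \<Rightarrow> 'g \<Rightarrow> complex" where
  "rep_character G \<rho> =
     (\<lambda>g. if g \<in> carrier G then (\<Sum>i<dim_row (\<rho> g). \<rho> g $$ (i, i)) else 0)"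

definition Irr :: "('g, 'b) monoid_scheme \<Rightarrow> ('g \<Rightarrow> complex) set" where
  "Irr G = {rep_character G \<rho> |n \<rho>. irreducible_rep G n \<rho>}"

definition linear_characters :: "('g, 'b) monoid_scheme \<Rightarrow> ('g \<Rightarrow> complex) set" where
  "linear_characters G = {rep_character G \<rho> |\<rho>. matrix_rep G 1 \<rho>}"

definition char_degree :: "('g, 'b) monoid_scheme \<Rightarrow> ('g \<Rightarrow> complex) \<Rightarrow> nat" where
  "char_degree G \<chi> = (THE d. of_nat d = \<chi> \<one>\<^bsub>G\<^esub>)"

lemma char_degree_rep_character:
  assumes "group G" "matrix_rep G n \<rho>"
  shows "char_degree G (rep_character G \<rho>) = n"
proof -
  have "\<one>\<^bsub>G\<^esub> \<in> carrier G"
    using assms(1) by (simp add: group.is_monoid)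
  hence "rep_character G \<rho> \<one>\<^bsub>G\<^esub> = of_nat n"
    using assms(2) by (simp add: rep_character_def matrix_rep_def)
  thus ?thesis
    by (auto simp: char_degree_def)
qed

text \<open>
  The usual formula for the induced character,
  \<open>\<theta>\<^sup>G(g) = 1/|H| \<Sum>\<^bsub>x \<in> G, x g x\<^sup>-\<^sup>1 \<in> H\<^esub> \<theta>(x g x\<^sup>-\<^sup>1)\<close>.
\<close>

definition induced :: "('g, 'b) monoid_scheme \<Rightarrow> 'g set \<Rightarrow> ('g \<Rightarrow> complex) \<Rightarrow> 'g \<Rightarrow> complex" where
  "induced G H \<theta> =
     (\<lambda>g. if g \<in> carrier G
          then (\<Sum>x | x \<in> carrier G \<and> x \<otimes>\<^bsub>G\<^esub> g \<otimes>\<^bsub>G\<^esub> inv\<^bsub>G\<^esub> x \<in> H.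
                  \<theta> (x \<otimes>\<^bsub>G\<^esub> g \<otimes>\<^bsub>G\<^esub> inv\<^bsub>G\<^esub> x)) / of_nat (card H)
          else 0)"

inductive_set monomial_monoid :: "('g, 'b) monoid_scheme \<Rightarrow> ('g \<Rightarrow> complex) set"
  for G :: "('g, 'b) monoid_scheme" where
  zero: "(\<lambda>_. 0) \<in> monomial_monoid G"
| add: "subgroup H G \<Longrightarrow> \<theta> \<in> linear_characters (G\<lparr>carrier := H\<rparr>) \<Longrightarrow>
        \<phi> \<in> monomial_monoid G \<Longrightarrow> (\<lambda>g. induced G H \<theta> g + \<phi> g) \<in> monomial_monoid G"


section \<open>Supercharacter theories\<close>

type_synonym 'g supertheory = "('g \<Rightarrow> complex) set set \<times> 'g set set"

definition superchar :: "('g, 'b) monoid_scheme \<Rightarrow> ('g \<Rightarrow> complex) set \<Rightarrow> 'g \<Rightarrow> complex" where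
  "superchar G X = (\<lambda>g. \<Sum>\<psi>\<in>X. \<psi> \<one>\<^bsub>G\<^esub> * \<psi> g)"

definition supercharacter_theory :: "('g, 'b) monoid_scheme \<Rightarrow> 'g supertheory \<Rightarrow> bool" where
  "supercharacter_theory G C \<longleftrightarrow>
     partition_on (Irr G) (fst C) \<and>
     partition_on (carrier G) (snd C) \<and>
     {\<one>\<^bsub>G\<^esub>} \<in> snd C \<and>
     card (fst C) = card (snd C) \<and>
     (\<forall>X\<in>fst C. \<forall>B\<in>snd C. \<exists>c. \<forall>g\<in>B. superchar G X g = c)"

text \<open>
  Families indexed by \<open>i = 1, \<dots>, m\<close> are indexed here by the members of the
  partition \<open>fst C = {X\<^sub>1, \<dots>, X\<^sub>m}\<close> themselves.
\<close>

definition superchar_comb ::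
    "('g, 'b) monoid_scheme \<Rightarrow> 'g supertheory \<Rightarrow> (('g \<Rightarrow> complex) set \<Rightarrow> nat) \<Rightarrow> 'g \<Rightarrow> complex" where
  "superchar_comb G C a = (\<lambda>g. \<Sum>X\<in>fst C. of_nat (a X) * superchar G X g)"

definition Ch_super :: "('g, 'b) monoid_scheme \<Rightarrow> 'g supertheory \<Rightarrow> ('g \<Rightarrow> complex) set" where
  "Ch_super G C = range (superchar_comb G C)"

definition M_super :: "('g, 'b) monoid_scheme \<Rightarrow> 'g supertheory \<Rightarrow> ('g \<Rightarrow> complex) set" where
  "M_super G C = Ch_super G C \<inter> monomial_monoid G"

definition almost_monomial :: "('g, 'b) monoid_scheme \<Rightarrow> 'g supertheory \<Rightarrow> bool" where
  "almost_monomial G C \<longleftrightarrow>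
     (\<forall>Xk\<in>fst C. \<forall>Xl\<in>fst C. Xk \<noteq> Xl \<longrightarrow>
       (\<exists>(t::nat) H \<Lambda> \<alpha>.
          (\<forall>j\<in>{1..t}. subgroup (H j) G \<and> \<Lambda> j \<in> linear_characters (G\<lparr>carrier := H j\<rparr>)) \<and>
          (\<lambda>g. \<Sum>j=1..t. induced G (H j) (\<Lambda> j) g) = superchar_comb G C \<alpha> \<and>
          \<alpha> Xk > 0 \<and> \<alpha> Xl = 0))"


section \<open>The algebra \<open>R\<^bsub>G,C\<^esub>\<close>\<close>

text \<open>
  Polynomials over \<open>'k\<close> whose variables \<open>x\<^sub>\<chi>\<close> are indexed by class functions; only the
  variables with \<open>\<chi> \<in> Irr G\<close> occur below.
\<close>

type_synonym ('g, 'k) char_poly_ring = "(('g \<Rightarrow> complex) \<Rightarrow>\<^sub>0 nat) \<Rightarrow>\<^sub>0 'k"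

definition char_var :: "('g \<Rightarrow> complex) \<Rightarrow> ('g, 'k::field) char_poly_ring" where
  "char_var \<chi> = Poly_Mapping.single (Poly_Mapping.single \<chi> 1) 1"

definition poly_scale :: "'k::field \<Rightarrow> ('g, 'k) char_poly_ring \<Rightarrow> ('g, 'k) char_poly_ring" where
  "poly_scale c p = Poly_Mapping.single 0 c * p"

lemma vector_space_poly_scale:
  "vector_space (poly_scale :: 'k::field \<Rightarrow> ('g, 'k) char_poly_ring \<Rightarrow> _)"
  by standard
    (simp_all add: poly_scale_def distrib_left distrib_right single_add mult_single
      flip: mult.assoc)

definition F_monom :: "('g, 'b) monoid_scheme \<Rightarrow> ('g \<Rightarrow> complex) set \<Rightarrow> ('g, 'k::field) char_poly_ring" where
  "F_monom G X = (\<Prod>\<chi>\<in>X. char_var \<chi> ^ char_degree G \<chi>)"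

definition R_alg :: "('g, 'b) monoid_scheme \<Rightarrow> 'g supertheory \<Rightarrow> ('g, 'k::field) char_poly_ring set" where
  "R_alg G C = Modules.module.span poly_scale
     {(\<Prod>X\<in>fst C. F_monom G X ^ a X) |a. superchar_comb G C a \<in> M_super G C}"

end

theory Submission
  imports Defs
begin

text \<open>
  Distinct exponent vectors on the \<open>F\<^sub>i\<close> give distinct monomials in the variables \<open>x\<^sub>\<chi>\<close>, since the
  \<open>X\<^sub>i\<close> are disjoint and nonempty and degrees are positive. As monomials are linearly independent,
  \<open>\<Prod>\<^sub>i F\<^sub>i ^ \<alpha>\<^sub>i\<close> lies in \<open>R\<^bsub>G,C\<^esub>\<close> iff \<open>\<Sum>\<^sub>i \<alpha>\<^sub>i \<sigma>\<^sub>i\<close> is a sum of monomial characters. This gives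
  (1) \<open>\<longleftrightarrow>\<close> (2), and (3) follows from (2) by adding up, for fixed \<open>l\<close>, the witnesses for all
  \<open>k \<noteq> l\<close>.
\<close>

section \<open>Linear independence of monomials\<close>

lemma keys_subset_if_in_span:
  assumes "p \<in> Modules.module.span poly_scale ((\<lambda>e. Poly_Mapping.single e 1) ` E)"
  shows "Poly_Mapping.keys p \<subseteq> E"
proof -
  interpret vector_space poly_scale
    by (rule vector_space_poly_scale)
  from assms show ?thesis
  proof (induction rule: span_induct_alt)
    case base
    then show ?case by simp
  next
    case (step c q p)
    \<comment> \<open>The constant \<open>single 0 c\<close> has support \<open>{0}\<close>, or
      \<open>{}\<close> if \<open>c = 0\<close>, so scaling shifts no exponent.\<close>
    have "Poly_Mapping.keys (poly_scale c q) \<subseteq> Poly_Mapping.keys q"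
      unfolding poly_scale_def
      using keys_mult[of "Poly_Mapping.single 0 c" q] by (auto split: if_splits)
    moreover have "Poly_Mapping.keys q \<subseteq> E"
      using step(1) by auto
    ultimately show ?case
      using step Poly_Mapping.keys_add[of "poly_scale c q" p] by blast
  qed
qed

text \<open>As 1 is nonzero in the field, the support of \<open>single e 1\<close> is
  \<open>{e}\<close>, and the support bound for the span applies.\<close>

lemma single_in_span_iff:
  "Poly_Mapping.single e 1
     \<in> Modules.module.span poly_scale ((\<lambda>e. Poly_Mapping.single e 1) ` E) \<longleftrightarrow> e \<in> E"
proof -
  interpret vector_space poly_scale
    by (rule vector_space_poly_scale)
  show ?thesis
    using keys_subset_if_in_span[of "Poly_Mapping.single e 1" E] by (auto intro: span_base)
qed

section \<open>Exponent vectors of products of the \<open>F_monom G X\<close>\<close>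

lemma char_var_power:
  "char_var \<chi> ^ n = Poly_Mapping.single (Poly_Mapping.single \<chi> n) 1"
  by (induction n) (simp_all add: char_var_def mult_single single_add[symmetric])

text \<open>For infinite \<open>I\<close> the default values also agree: the product is 1, the sum
  is 0, and \<open>single 0 1 = 1\<close>.\<close>

lemma prod_single_one:
  "(\<Prod>i\<in>I. Poly_Mapping.single (e i) (1 :: 'k::comm_semiring_1))
     = Poly_Mapping.single (\<Sum>i\<in>I. e i :: 'a::comm_monoid_add) 1"
  by (induction I rule: infinite_finite_induct) (simp_all add: mult_single)

text \<open>A sum of \<open>single\<close>s has finite support automatically; an infinite block
  contributes 0.\<close>

definition F_exponent ::
    "('g, 'b) monoid_scheme \<Rightarrow> ('g \<Rightarrow> complex) set set \<Rightarrow> (('g \<Rightarrow> complex) set \<Rightarrow> nat)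
      \<Rightarrow> ('g \<Rightarrow> complex) \<Rightarrow>\<^sub>0 nat" where
  "F_exponent G \<X> a = (\<Sum>X\<in>\<X>. \<Sum>\<chi>\<in>X. Poly_Mapping.single \<chi> (char_degree G \<chi> * a X))"

lemma prod_F_monom:
  "(\<Prod>X\<in>\<X>. F_monom G X ^ a X :: ('a, 'k::field) char_poly_ring)
     = Poly_Mapping.single (F_exponent G \<X> a) 1"
proof -
  have "(F_monom G X :: ('a, 'k) char_poly_ring) ^ a X
      = (\<Prod>\<chi>\<in>X. char_var \<chi> ^ (char_degree G \<chi> * a X))" for X
    unfolding F_monom_def prod_power_distrib power_mult ..
  then show ?thesis
    by (simp add: F_exponent_def char_var_power prod_single_one)
qed

text \<open>By disjointness, \<open>\<chi>\<close> occurs as a variable in the factor of one block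
  only, so no other block contributes.\<close>

lemma lookup_F_exponent:
  assumes "finite \<X>" "disjoint \<X>" "X \<in> \<X>" "finite X" "\<chi> \<in> X"
  shows "Poly_Mapping.lookup (F_exponent G \<X> a) \<chi> = char_degree G \<chi> * a X"
proof -
  have inner: "(\<Sum>\<psi>\<in>Y. Poly_Mapping.lookup (Poly_Mapping.single \<psi> (char_degree G \<psi> * a Y)) \<chi>)
      = (if Y = X then char_degree G \<chi> * a X else 0)" if "Y \<in> \<X>" for Y
  proof (cases "Y = X")
    case True
    then show ?thesis
      using assms by (simp add: lookup_single when_def)
  next
    case False
    then have "\<chi> \<notin> Y"
      using assms that disjointD by blast
    then have "(\<Sum>\<psi>\<in>Y. Poly_Mapping.lookup (Poly_Mapping.single \<psi> (char_degree G \<psi> * a Y)) \<chi>) = 0"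
      by (intro sum.neutral) (auto simp: lookup_single when_def)
    with False show ?thesis
      by simp
  qed
  show ?thesis
    using assms inner by (simp add: F_exponent_def lookup_sum)
qed

lemma char_degree_pos:
  assumes "group G" "\<chi> \<in> Irr G"
  shows "char_degree G \<chi> > 0"
  using assms by (auto simp: Irr_def irreducible_rep_def char_degree_rep_character)

text \<open>Injectivity of exponent vectors, up to the character they describe. Each block has a
  member; if the block is finite, reading off the exponent of that member and cancelling its
  positive degree recovers the coefficient.\<close>

lemma superchar_comb_eq_if_F_exponent_eq:
  assumes "group G" "partition_on (Irr G) (fst C)" "finite (fst C)"
    and eq: "F_exponent G (fst C) a = F_exponent G (fst C) b"
  shows "superchar_comb G C a = superchar_comb G C b"
proof -
  have "of_nat (a X) * superchar G X g = of_nat (b X) * superchar G X g"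
    if X: "X \<in> fst C" for X g
  proof (cases "finite X")
    case True
    obtain \<chi> where \<chi>: "\<chi> \<in> X" "\<chi> \<in> Irr G"
      using partition_onD1[OF assms(2)] partition_onD3[OF assms(2)] X by (metis UnionI equals0I)
    have "char_degree G \<chi> * a X = char_degree G \<chi> * b X"
      using lookup_F_exponent[OF assms(3) partition_onD2[OF assms(2)] X True \<chi>(1)] eq
      by metis
    then show ?thesis
      using char_degree_pos[OF assms(1) \<chi>(2)] by simp
  next
    \<comment> \<open>Without appeal to the finiteness of \<open>Irr G\<close>: an infinite sum is \<open>0\<close> by convention,
      just as an infinite product is \<open>1\<close> and thus invisible in \<open>F_exponent\<close>.\<close>
    case False
    then show ?thesis
      by (simp add: superchar_def)
  qed
  then show ?thesis
    unfolding superchar_comb_def by (intro ext sum.cong) blast+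
qed

text \<open>The bridge between algebra and characters: every later claim about \<open>R_alg\<close>
  is decided in \<open>monomial_monoid\<close>.\<close>

lemma prod_F_monom_in_R_alg_iff:
  assumes "group G" "partition_on (Irr G) (fst C)" "finite (fst C)"
  shows "(\<Prod>X\<in>fst C. F_monom G X ^ a X) \<in> (R_alg G C :: ('g, 'k::field) char_poly_ring set)
     \<longleftrightarrow> superchar_comb G C a \<in> monomial_monoid G"
proof -
  let ?A = "{a. superchar_comb G C a \<in> monomial_monoid G}"
  have "{(\<Prod>X\<in>fst C. F_monom G X ^ a X) |a. superchar_comb G C a \<in> M_super G C}
      = (\<lambda>e. Poly_Mapping.single e (1 :: 'k)) ` F_exponent G (fst C) ` ?A"
    by (auto simp: prod_F_monom M_super_def Ch_super_def)
  then have "(\<Prod>X\<in>fst C. F_monom G X ^ a X) \<in> (R_alg G C :: ('g, 'k) char_poly_ring set)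
      \<longleftrightarrow> F_exponent G (fst C) a \<in> F_exponent G (fst C) ` ?A"
    by (simp add: R_alg_def prod_F_monom single_in_span_iff)
  \<comment> \<open>A priori only some \<open>b\<close> with the same exponent vector has its
    character in the monoid; that character is also the one of \<open>a\<close>.\<close>
  also have "\<dots> \<longleftrightarrow> a \<in> ?A"
  proof
    assume "F_exponent G (fst C) a \<in> F_exponent G (fst C) ` ?A"
    then obtain b where "F_exponent G (fst C) a = F_exponent G (fst C) b" "b \<in> ?A"
      by blast
    then show "a \<in> ?A"
      using superchar_comb_eq_if_F_exponent_eq[OF assms, of a b] by simp
  qed (rule imageI)
  finally show ?thesis
    by simp
qed

section \<open>Sums of monomial characters\<close>

lemma monomial_monoid_add:
  assumes "\<phi> \<in> monomial_monoid G" "\<psi> \<in> monomial_monoid G"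
  shows "(\<lambda>g. \<phi> g + \<psi> g) \<in> monomial_monoid G"
  using assms
proof (induction rule: monomial_monoid.induct)
  case zero
  then show ?case by simp
next
  case (add H \<theta> \<phi>)
  then show ?case
    using monomial_monoid.add[of H G \<theta> "\<lambda>g. \<phi> g + \<psi> g"] by (simp add: add.assoc)
qed

lemma monomial_monoid_sum:
  assumes "\<And>i. i \<in> I \<Longrightarrow> \<phi> i \<in> monomial_monoid G"
  shows "(\<lambda>g. \<Sum>i\<in>I. \<phi> i g) \<in> monomial_monoid G"
  using assms
  by (induction I rule: infinite_finite_induct)
    (auto intro: monomial_monoid.zero monomial_monoid_add)

lemma induced_in_monomial_monoid:
  assumes "subgroup H G" "\<theta> \<in> linear_characters (G\<lparr>carrier := H\<rparr>)"
  shows "induced G H \<theta> \<in> monomial_monoid G"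
  using monomial_monoid.add[OF assms monomial_monoid.zero] by simp

text \<open>Links the inductive monoid to the indexed families in
  \<open>almost_monomial\<close>.\<close>

lemma monomial_monoid_iff:
  "\<phi> \<in> monomial_monoid G \<longleftrightarrow>
     (\<exists>(t::nat) H \<Lambda>.
        (\<forall>j\<in>{1..t}. subgroup (H j) G \<and> \<Lambda> j \<in> linear_characters (G\<lparr>carrier := H j\<rparr>)) \<and>
        (\<lambda>g. \<Sum>j=1..t. induced G (H j) (\<Lambda> j) g) = \<phi>)"
    (is "_ \<longleftrightarrow> ?sum \<phi>")
proof
  assume "\<phi> \<in> monomial_monoid G"
  then show "?sum \<phi>"
  proof induction
    case zero
    show ?case by (rule exI[of _ 0]) auto
  next
    case (add H' \<theta> \<phi>)
    then obtain t :: nat and H \<Lambda> where *: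
      "\<forall>j\<in>{1..t}. subgroup (H j) G \<and> \<Lambda> j \<in> linear_characters (G\<lparr>carrier := H j\<rparr>)"
      "(\<lambda>g. \<Sum>j=1..t. induced G (H j) (\<Lambda> j) g) = \<phi>"
      by blast
    \<comment> \<open>The new summand takes index \<open>Suc t\<close>, which leaves the first
      \<open>t\<close> entries untouched.\<close>
    have "(\<Sum>j=1..Suc t. induced G ((H(Suc t := H')) j) ((\<Lambda>(Suc t := \<theta>)) j) g)
        = induced G H' \<theta> g + \<phi> g" for g
    proof -
      have "(\<Sum>j=1..t. induced G ((H(Suc t := H')) j) ((\<Lambda>(Suc t := \<theta>)) j) g) = \<phi> g"
        unfolding *(2)[symmetric] by (rule sum.cong) auto
      then show ?thesis
        by simp
    qed
    moreover have "\<forall>j\<in>{1..Suc t}. subgroup ((H(Suc t := H')) j) G \<and>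
        (\<Lambda>(Suc t := \<theta>)) j \<in> linear_characters (G\<lparr>carrier := (H(Suc t := H')) j\<rparr>)"
      using *(1) add.hyps by (auto simp: le_Suc_eq)
    ultimately show ?case
      by blast
  qed
next
  assume "?sum \<phi>"
  then show "\<phi> \<in> monomial_monoid G"
    by (auto intro!: monomial_monoid_sum induced_in_monomial_monoid)
qed

lemma almost_monomial_iff:
  "almost_monomial G C \<longleftrightarrow>
     (\<forall>Xk\<in>fst C. \<forall>Xl\<in>fst C. Xk \<noteq> Xl \<longrightarrow>
       (\<exists>\<alpha>. superchar_comb G C \<alpha> \<in> monomial_monoid G \<and> \<alpha> Xk > 0 \<and> \<alpha> Xl = 0))"
proof -
  \<comment> \<open>With \<open>\<alpha>\<close> quantified first, the inner existentials become the
    right side of \<open>monomial_monoid_iff\<close>.\<close>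
  have swap: "(\<exists>t H \<Lambda> \<alpha>. A t H \<Lambda> \<and> B t H \<Lambda> \<alpha> \<and> P \<alpha>) \<longleftrightarrow>
      (\<exists>\<alpha>. (\<exists>t H \<Lambda>. A t H \<Lambda> \<and> B t H \<Lambda> \<alpha>) \<and> P \<alpha>)"
    for A :: "nat \<Rightarrow> (nat \<Rightarrow> 'a set) \<Rightarrow> (nat \<Rightarrow> 'a \<Rightarrow> complex) \<Rightarrow> bool" and B
      and P :: "(('a \<Rightarrow> complex) set \<Rightarrow> nat) \<Rightarrow> bool"
    by blast
  show ?thesis
    unfolding almost_monomial_def monomial_monoid_iff swap ..
qed

lemma superchar_comb_sum:
  "superchar_comb G C (\<lambda>X. \<Sum>i\<in>I. a i X) = (\<lambda>g. \<Sum>i\<in>I. superchar_comb G C (a i) g)"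
  unfolding superchar_comb_def of_nat_sum sum_distrib_right
  by (rule ext) (rule sum.swap)

section \<open>Equivalence of the three conditions for an enumerated partition\<close>

theorem proposition3p5:
  fixes G :: "('g, 'b) monoid_scheme"
    and C :: "'g supertheory"
    and m :: nat
    and X :: "nat \<Rightarrow> ('g \<Rightarrow> complex) set"
  assumes "group G" and "finite (carrier G)"
    and "supercharacter_theory G C"
    and "bij_betw X {1..m} (fst C)"
  shows "(almost_monomial G C \<longleftrightarrow>
            (\<forall>k\<in>{1..m}. \<forall>l\<in>{1..m}. k \<noteq> l \<longrightarrow>
              (\<exists>\<alpha>::nat \<Rightarrow> nat.
                 (\<Prod>i\<in>{1..m}. F_monom G (X i) ^ \<alpha> i) \<in> (R_alg G C :: ('g, 'k::field) char_poly_ring set)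
                 \<and> \<alpha> k > 0 \<and> \<alpha> l = 0)))
       \<and> ((\<forall>k\<in>{1..m}. \<forall>l\<in>{1..m}. k \<noteq> l \<longrightarrow>
              (\<exists>\<alpha>::nat \<Rightarrow> nat.
                 (\<Prod>i\<in>{1..m}. F_monom G (X i) ^ \<alpha> i) \<in> (R_alg G C :: ('g, 'k) char_poly_ring set)
                 \<and> \<alpha> k > 0 \<and> \<alpha> l = 0))
          \<longleftrightarrow>
          (\<forall>l\<in>{1..m}. \<exists>\<alpha>::nat \<Rightarrow> nat.
              (\<forall>i\<in>{1..m} - {l}. \<alpha> i > 0) \<and>
              (\<Prod>i\<in>{1..m} - {l}. F_monom G (X i) ^ \<alpha> i) \<in> (R_alg G C :: ('g, 'k) char_poly_ring set)))"
    (is "(_ \<longleftrightarrow> ?P2) \<and> (?P2 \<longleftrightarrow> ?P3)")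
proof -
  let ?R = "R_alg G C :: ('g, 'k) char_poly_ring set"
  let ?F = "\<lambda>\<alpha>. (\<Prod>i\<in>{1..m}. F_monom G (X i) ^ \<alpha> i) :: ('g, 'k) char_poly_ring"
  \<comment> \<open>Inverse of the enumeration: \<open>\<alpha> \<circ> Y\<close> turns coefficients
    on \<open>{1..m}\<close> into coefficients on blocks.\<close>
  define Y where "Y = the_inv_into {1..m} X"
  have inj: "inj_on X {1..m}" and im: "X ` {1..m} = fst C"
    using assms(4) by (auto simp: bij_betw_def)
  have YX: "Y (X i) = i" if "i \<in> {1..m}" for i
    using that inj by (simp add: Y_def the_inv_into_f_f)
  have part: "partition_on (Irr G) (fst C)" and fin: "finite (fst C)"
    using assms(3) bij_betw_finite[OF assms(4)] by (auto simp: supercharacter_theory_def)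
  have in_R_iff: "?F (\<lambda>i. a (X i)) \<in> ?R \<longleftrightarrow> superchar_comb G C a \<in> monomial_monoid G" for a
    using prod_F_monom_in_R_alg_iff[OF assms(1) part fin, of a, where 'k = 'k]
    by (simp only: prod.reindex_bij_betw[OF assms(4), of "\<lambda>X. F_monom G X ^ a X"])
  have in_R_iff_Y: "?F \<alpha> \<in> ?R \<longleftrightarrow> superchar_comb G C (\<alpha> \<circ> Y) \<in> monomial_monoid G" for \<alpha>
  proof -
    have "?F \<alpha> = ?F (\<lambda>i. (\<alpha> \<circ> Y) (X i))"
      by (intro prod.cong) (simp_all add: YX)
    then show ?thesis
      by (simp only: in_R_iff)
  qed
  have P12: "almost_monomial G C \<longleftrightarrow> ?P2"
  proof
    assume am: "almost_monomial G C"
    show ?P2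
    proof (intro ballI impI)
      fix k l assume kl: "k \<in> {1..m}" "l \<in> {1..m}" "k \<noteq> l"
      then have "X k \<in> fst C" "X l \<in> fst C" "X k \<noteq> X l"
        using im inj by (auto dest: inj_onD)
      then obtain a where "superchar_comb G C a \<in> monomial_monoid G" "a (X k) > 0" "a (X l) = 0"
        using am unfolding almost_monomial_iff by blast
      then show "\<exists>\<alpha>. ?F \<alpha> \<in> ?R \<and> \<alpha> k > 0 \<and> \<alpha> l = 0"
        using in_R_iff[of a] by (intro exI[of _ "\<lambda>i. a (X i)"]) simp
    qed
  next
    assume P2: ?P2
    show "almost_monomial G C"
      unfolding almost_monomial_iff
    proof (intro ballI impI)
      fix Xk Xl assume *: "Xk \<in> fst C" "Xl \<in> fst C" "Xk \<noteq> Xl"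
      then obtain k l where kl: "k \<in> {1..m}" "l \<in> {1..m}" "Xk = X k" "Xl = X l"
        unfolding im[symmetric] by (elim imageE)
      with * have "k \<noteq> l"
        by blast
      then obtain \<alpha> where \<alpha>: "?F \<alpha> \<in> ?R" "\<alpha> k > 0" "\<alpha> l = 0"
        using P2[rule_format, OF kl(1,2)] by blast
      then have "superchar_comb G C (\<alpha> \<circ> Y) \<in> monomial_monoid G"
        by (simp only: in_R_iff_Y)
      then show "\<exists>a. superchar_comb G C a \<in> monomial_monoid G \<and> a Xk > 0 \<and> a Xl = 0"
        using \<alpha> kl YX by (intro exI[of _ "\<alpha> \<circ> Y"]) simp
    qed
  qed
  \<comment> \<open>Closure of \<open>?R\<close> under products of such monomials, obtained by
    adding the corresponding characters.\<close>
  have F_sum: "?F (\<lambda>i. \<Sum>k\<in>I. \<alpha> k i) \<in> ?R" if \<alpha>: "\<And>k. k \<in> I \<Longrightarrow> ?F (\<alpha> k) \<in> ?R"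
    for I :: "nat set" and \<alpha>
  proof -
    have "superchar_comb G C (\<alpha> k \<circ> Y) \<in> monomial_monoid G" if "k \<in> I" for k
      using \<alpha>[OF that] by (simp only: in_R_iff_Y)
    then have "superchar_comb G C (\<lambda>X. \<Sum>k\<in>I. (\<alpha> k \<circ> Y) X) \<in> monomial_monoid G"
      by (simp only: superchar_comb_sum) (rule monomial_monoid_sum)
    then show ?thesis
      unfolding in_R_iff_Y comp_def .
  qed
  have F_remove: "?F \<alpha> = (\<Prod>i\<in>{1..m} - {l}. F_monom G (X i) ^ \<alpha> i)"
    if "l \<in> {1..m}" "\<alpha> l = 0" for \<alpha> l
    using that by (subst prod.remove[of _ l]) auto
  have "?P2 \<longleftrightarrow> ?P3"
  proof
    assume P2: ?P2
    show ?P3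
    proof
      fix l assume l: "l \<in> {1..m}"
      let ?I = "{1..m} - {l}"
      have "\<forall>k\<in>?I. \<exists>\<alpha>. ?F \<alpha> \<in> ?R \<and> \<alpha> k > 0 \<and> \<alpha> l = 0"
        using P2 l by blast
      then have "\<exists>\<alpha>. \<forall>k\<in>?I. ?F (\<alpha> k) \<in> ?R \<and> \<alpha> k k > 0 \<and> \<alpha> k l = 0"
        by (rule bchoice)
      then obtain \<alpha> where \<alpha>: "\<And>k. k \<in> ?I \<Longrightarrow> ?F (\<alpha> k) \<in> ?R"
          "\<And>k. k \<in> ?I \<Longrightarrow> \<alpha> k k > 0" "\<And>k. k \<in> ?I \<Longrightarrow> \<alpha> k l = 0"
        by blast
      \<comment> \<open>The summand \<open>\<alpha> i i\<close> makes \<open>\<beta> i\<close>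
        positive. If \<open>m = 1\<close>, then \<open>?I\<close> is empty, \<open>\<beta>\<close>
        is 0 and the monomial is 1.\<close>
      define \<beta> where "\<beta> i = (\<Sum>k\<in>?I. \<alpha> k i)" for i
      have "?F \<beta> \<in> ?R"
        unfolding \<beta>_def using \<alpha>(1) by (rule F_sum)
      moreover have "\<beta> l = 0"
        using \<alpha>(3) by (simp add: \<beta>_def)
      moreover have "\<beta> i > 0" if "i \<in> ?I" for i
        unfolding \<beta>_def using \<alpha>(2)[OF that] that by (intro sum_pos2[of _ i]) auto
      ultimately show "\<exists>\<alpha>. (\<forall>i\<in>?I. \<alpha> i > 0) \<and> (\<Prod>i\<in>?I. F_monom G (X i) ^ \<alpha> i) \<in> ?R"
        using F_remove[where \<alpha> = \<beta>, OF l] by (intro exI[of _ \<beta>]) simp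
    qed
  next
    assume P3: ?P3
    show ?P2
    proof (intro ballI impI)
      fix k l assume kl: "k \<in> {1..m}" "l \<in> {1..m}" "k \<noteq> l"
      then obtain \<alpha> where \<alpha>: "\<forall>i\<in>{1..m} - {l}. \<alpha> i > 0"
          "(\<Prod>i\<in>{1..m} - {l}. F_monom G (X i) ^ \<alpha> i) \<in> ?R"
        using P3[rule_format, OF kl(2)] by blast
      \<comment> \<open>Condition (3) leaves \<open>\<alpha> l\<close> arbitrary, so it is reset to
        0.\<close>
      have "?F (\<alpha>(l := 0)) = (\<Prod>i\<in>{1..m} - {l}. F_monom G (X i) ^ \<alpha> i)"
        using F_remove[where \<alpha> = "\<alpha>(l := 0)", OF kl(2)] by simp
      then show "\<exists>\<alpha>. ?F \<alpha> \<in> ?R \<and> \<alpha> k > 0 \<and> \<alpha> l = 0"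
        using \<alpha> kl by (intro exI[of _ "\<alpha>(l := 0)"]) auto
    qed
  qed
  with P12 show ?thesis ..
qed

end
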